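(* Let $K$ be an infinite field and let $K\subset L$ be a finite simple field extension. Then $$m(K,L)=n-n(K,L),$$ where $n=[L:K]$, $$n(K,L)=\max\{[F:K]:\ F \text{ is an intermediate field of } K\subset L \text{ with } F\neq L\},$$ and $$m(K,L)=\max\{\dim_K V:\ V\subset L \text{ is a } K\text{-subspace and } K(a)=L \text{ for any } a\in V\setminus\{0\}\}.$$
   Context: The extension $K\subset L$ is simple if $L=K(\alpha)$ for some $\alpha\in L$. The quantity $n(K,L)$ is defined only when $K\neq L$ (so that there is at least one intermediate field $F\ne L$), which is implicit in the statement. *)

theory Defs
  imports "HOL-Algebra.Algebra"
begin

text \<open>
  An extension of fields is a field \<open>L\<close> together with \<open>subfield K L\<close>. A \<open>K\<close>-subspace of \<open>L\<close> is
  rendered by the library predicate \<open>subalgebra K V L\<close>: despite its name it only asks for an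
  additive subgroup of \<open>L\<close> closed under multiplication by elements of \<open>K\<close>.
\<close>

definition adjoin :: "('a, 'b) ring_scheme \<Rightarrow> 'a set \<Rightarrow> 'a \<Rightarrow> 'a set" where
  "adjoin L K a = generate_field L (insert a K)"

definition simple_field_extension :: "('a, 'b) ring_scheme \<Rightarrow> 'a set \<Rightarrow> bool" where
  "simple_field_extension L K \<longleftrightarrow> (\<exists>a \<in> carrier L. adjoin L K a = carrier L)"

definition intermediate_field :: "('a, 'b) ring_scheme \<Rightarrow> 'a set \<Rightarrow> 'a set \<Rightarrow> bool" where
  "intermediate_field L K F \<longleftrightarrow> subfield F L \<and> K \<subseteq> F"

definition primitive_subspace :: "('a, 'b) ring_scheme \<Rightarrow> 'a set \<Rightarrow> 'a set \<Rightarrow> bool" where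
  "primitive_subspace L K V \<longleftrightarrow>
     subalgebra K V L \<and> (\<forall>a \<in> V - {\<zero>\<^bsub>L\<^esub>}. adjoin L K a = carrier L)"

text \<open>
  \<open>Max\<close> is meaningful only on finite nonempty sets, which for the two sets below is the content of
  the lemmas at the end of this theory (the first one needs \<open>K \<noteq> carrier L\<close>).
\<close>

definition max_proper_degree :: "('a, 'b) ring_scheme \<Rightarrow> 'a set \<Rightarrow> nat" where
  "max_proper_degree L K =
     Max {ring.dim L K F | F. intermediate_field L K F \<and> F \<noteq> carrier L}"

definition max_primitive_dim :: "('a, 'b) ring_scheme \<Rightarrow> 'a set \<Rightarrow> nat" where
  "max_primitive_dim L K = Max {ring.dim L K V | V. primitive_subspace L K V}"

lemma (in field) subspace_dim_le:
  assumes "subfield K R" "finite_dimension K (carrier R)" "subalgebra K V R"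
  shows "finite_dimension K V" and "dim K V \<le> dim K (carrier R)"
proof -
  show fin: "finite_dimension K V"
    using subalbegra_incl_imp_finite_dimension[OF assms subalgebra_in_carrier[OF assms(3)]] .
  have dV: "dimension (dim K V) K V" and dR: "dimension (dim K (carrier R)) K (carrier R)"
    using finite_dimensionE[OF assms(1) fin] finite_dimensionE[OF assms(1,2)]
    by (simp_all add: over_def)
  obtain Vs where Vs: "set Vs \<subseteq> carrier R" "independent K Vs" "length Vs = dim K V"
    using exists_base[OF assms(1) dV] by blast
  show "dim K V \<le> dim K (carrier R)"
    using independent_length_le_dimension[OF assms(1) dR Vs(2,1)] Vs(3) by simp
qed

lemma (in field) intermediate_field_subspace:
  assumes "intermediate_field R K F"
  shows "subalgebra K F R"
  using assms subringE(6)[OF subfieldE(1), of F]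
  unfolding intermediate_field_def subalgebra_def subalgebra_axioms_def
  by (auto dest: subfieldE(1) subring.axioms(1))

lemma (in field) max_proper_degree_wf:
  assumes "subfield K R" "finite_dimension K (carrier R)" "K \<noteq> carrier R"
  defines "D \<equiv> {dim K F | F. intermediate_field R K F \<and> F \<noteq> carrier R}"
  shows "finite D" and "D \<noteq> {}"
proof -
  have "D \<subseteq> {..dim K (carrier R)}"
    using subspace_dim_le(2)[OF assms(1,2)] intermediate_field_subspace by (auto simp: D_def)
  then show "finite D"
    by (rule finite_subset) simp
  show "D \<noteq> {}"
    using assms(1,3) by (auto simp: D_def intermediate_field_def)
qed

lemma (in field) max_primitive_dim_wf:
  assumes "subfield K R" "finite_dimension K (carrier R)"
  defines "D \<equiv> {dim K V | V. primitive_subspace R K V}"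
  shows "finite D" and "D \<noteq> {}"
proof -
  have "D \<subseteq> {..dim K (carrier R)}"
    using subspace_dim_le(2)[OF assms(1,2)] by (auto simp: D_def primitive_subspace_def)
  then show "finite D"
    by (rule finite_subset) simp
  have "subalgebra K {\<zero>} R"
    using finite_dimension_imp_subalgebra[OF assms(1) finite_dimensionI[OF zero_dim]] .
  then have "primitive_subspace R K {\<zero>}"
    by (simp add: primitive_subspace_def)
  then show "D \<noteq> {}"
    by (auto simp: D_def)
qed

end

theory Submission
  imports Defs
begin

text \<open>
  A subspace \<open>V\<close> is primitive iff it meets every proper intermediate field only in \<open>0\<close>, because a
  nonzero \<open>a \<in> V\<close> fails to generate \<open>L\<close> exactly when \<open>K(a)\<close> is such a field. Comparing
  with a proper \<open>F\<close> of maximal degree gives \<open>dim V + [F : K] \<le> n\<close>. Conversely, as the extension is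
  simple there are only finitely many intermediate fields \<open>F\<close> (Steinitz): \<open>F\<close> is determined by the
  minimal polynomial over \<open>F\<close> of a generator, which is a monic divisor of the one over \<open>K\<close>. As long
  as \<open>dim V < n - n(K, L)\<close>, the finitely many spaces \<open>V + F\<close> are proper and so do not cover \<open>L\<close>, the
  field \<open>K\<close> being infinite; a vector outside all of them enlarges \<open>V\<close>.
\<close>

section \<open>Finiteness of the set of intermediate fields\<close>

lemma finite_submultisets: "finite {A. A \<subseteq># M}"
proof (rule finite_subset)
  show "{A. A \<subseteq># M} \<subseteq> mset ` {xs. set xs \<subseteq> set_mset M \<and> length xs \<le> size M}"
  proof
    fix A assume "A \<in> {A. A \<subseteq># M}"
    moreover obtain xs where "mset xs = A"
      using ex_mset by blast
    ultimately show "A \<in> mset ` {xs. set xs \<subseteq> set_mset M \<and> length xs \<le> size M}"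
      using set_mset_mono[of A M] size_mset_mono[of A M] by force
  qed
  show "finite (mset ` {xs. set xs \<subseteq> set_mset M \<and> length xs \<le> size M})"
    by (simp add: finite_lists_length_le)
qed

text \<open>The multiset of irreducible factors, taken up to association, determines an element up
  to association, and for a divisor of \<open>b\<close> it is a submultiset of that of
  \<open>b\<close>. Since \<open>A\<close> has at most one element in each association class, it
  injects into the finite set of these submultisets.\<close>

lemma (in factorial_monoid) finite_divisors_up_to_association:
  assumes b: "b \<in> carrier G"
    and A: "A \<subseteq> carrier G" "\<And>a. a \<in> A \<Longrightarrow> a divides b"
    and inj: "\<And>a a'. \<lbrakk> a \<in> A; a' \<in> A; a \<sim> a' \<rbrakk> \<Longrightarrow> a = a'"
  shows "finite A"
proof -
  obtain bs where bs: "set bs \<subseteq> carrier G" "wfactors G bs b"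
    using wfactors_exist[OF b] by blast
  have "\<forall>a\<in>A. \<exists>as. set as \<subseteq> carrier G \<and> wfactors G as a"
    using wfactors_exist A(1) by blast
  then obtain f where f: "\<And>a. a \<in> A \<Longrightarrow> set (f a) \<subseteq> carrier G"
      "\<And>a. a \<in> A \<Longrightarrow> wfactors G (f a) a"
    by metis
  show ?thesis
  proof (rule inj_on_finite)
    show "inj_on (\<lambda>a. fmset G (f a)) A"
    proof (rule inj_onI)
      fix a a' assume *: "a \<in> A" "a' \<in> A" "fmset G (f a) = fmset G (f a')"
      then have "a divides a'" "a' divides a"
        using fmsubset_divides[of "f a" "f a'" a a'] fmsubset_divides[of "f a'" "f a" a' a] f A(1)
        by (auto simp: subset_iff)
      then show "a = a'"
        using inj * by (auto intro: associatedI)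
    qed
    show "(\<lambda>a. fmset G (f a)) ` A \<subseteq> {M. M \<subseteq># fmset G bs}"
      using divides_fmsubset[OF A(2) f(2) bs(2) _ b f(1) bs(1)] A(1) by auto
    show "finite {M. M \<subseteq># fmset G bs}"
      by (rule finite_submultisets)
  qed
qed

context field
begin

text \<open>Associated polynomials over a field differ by a nonzero constant factor; comparing
  leading coefficients shows that it is \<open>\<one>\<close>.\<close>

lemma monic_associated_imp_eq:
  assumes p: "p \<in> carrier (poly_ring R)" "lead_coeff p = \<one>"
    and q: "q \<in> carrier (poly_ring R)" "q \<noteq> []" "lead_coeff q = \<one>"
    and assoc: "p \<sim>\<^bsub>poly_ring R\<^esub> q"
  shows "p = q"
proof -
  obtain k where k: "k \<in> carrier R - {\<zero>}" "p = [k] \<otimes>\<^bsub>poly_ring R\<^esub> q"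
    using associated_polynomials_iff[OF carrier_is_subfield p(1) q(1)] assoc by blast
  have poly: "polynomial (carrier R) q"
    using q(1) by (simp add: univ_poly_carrier)
  have eq: "p = map (\<lambda>b. k \<otimes> b) q"
    using poly_mult_const(1)[OF carrier_is_subring poly k(1)] k(2) by (simp add: univ_poly_mult)
  then have "lead_coeff p = k \<otimes> lead_coeff q"
    using q(2) by (simp add: hd_map)
  then have "k = \<one>"
    using p(2) q(3) k(1) by simp
  moreover have "set q \<subseteq> carrier R"
    using polynomial_incl[OF poly] .
  ultimately show ?thesis
    using eq by (simp add: map_idI subset_iff)
qed

lemma finite_monic_divisors:
  assumes p: "p \<in> carrier (poly_ring R)" "p \<noteq> []"
  shows "finite {q \<in> carrier (poly_ring R). q \<noteq> [] \<and> lead_coeff q = \<one> \<and> q pdivides p}"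
proof -
  interpret UP: principal_domain "poly_ring R"
    using univ_poly_is_principal[OF carrier_is_subfield] .
  show ?thesis
  \<comment> \<open>The factorial monoid is \<open>mult_of (poly_ring R)\<close>, the nonzero
    polynomials under multiplication, so divisibility is transferred from the ring to it and
    association back.\<close>
  proof (rule UP.mult_of.finite_divisors_up_to_association[of p])
    show "p \<in> carrier (mult_of (poly_ring R))"
      using p by (simp add: univ_poly_zero)
  next
    fix q assume "q \<in> {q \<in> carrier (poly_ring R). q \<noteq> [] \<and> lead_coeff q = \<one> \<and> q pdivides p}"
    then show "q divides\<^bsub>mult_of (poly_ring R)\<^esub> p"
      using p by (auto simp: pdivides_def univ_poly_zero intro!: UP.divides_imp_divides_mult)
  next
    fix q q'
    assume q: "q \<in> {q \<in> carrier (poly_ring R). q \<noteq> [] \<and> lead_coeff q = \<one> \<and> q pdivides p}"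
      "q' \<in> {q \<in> carrier (poly_ring R). q \<noteq> [] \<and> lead_coeff q = \<one> \<and> q pdivides p}"
      and "q \<sim>\<^bsub>mult_of (poly_ring R)\<^esub> q'"
    then have "q \<sim>\<^bsub>poly_ring R\<^esub> q'"
      using UP.assoc_iff_assoc_mult[of q q'] by simp
    then show "q = q'"
      using monic_associated_imp_eq q by blast
  qed (auto simp: univ_poly_zero)
qed

section \<open>Intermediate fields and the minimal polynomial of a generator\<close>

lemma subfield_inter:
  assumes "subfield E R" "subfield F R"
  shows "subfield (E \<inter> F) R"
proof (rule subfieldI')
  show "subring (E \<inter> F) R"
    using subring_inter subfieldE(1) assms by blast
  show "inv k \<in> E \<inter> F" if "k \<in> E \<inter> F - {\<zero>}" for k
    using subfield_m_inv(1)[OF assms(1), of k] subfield_m_inv(1)[OF assms(2), of k] that by blast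
qed

text \<open>A basis over \<open>K\<close> still spans over the larger field
  \<open>E\<close>.\<close>

lemma finite_dimension_subfield_mono:
  assumes K: "subfield K R" and fin: "finite_dimension K (carrier R)"
    and E: "subfield E R" "K \<subseteq> E"
  shows "finite_dimension E (carrier R)"
proof -
  obtain n where "dimension n K (carrier R)"
    using fin by blast
  then obtain Vs where Vs: "set Vs \<subseteq> carrier R" "Span K Vs = carrier R"
    using exists_base[OF K] by blast
  have "carrier R \<subseteq> Span E Vs"
    using Span_eq_combine_set[OF K Vs(1)] Span_eq_combine_set[OF E(1) Vs(1)] Vs(2) E(2) by blast
  then have "Span E Vs = carrier R"
    using Span_in_carrier[OF subfieldE(3)[OF E(1)] Vs(1)] by blast
  then show ?thesis
    using Span_finite_dimension[OF E(1) Vs(1)] by simp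
qed

lemma algebraic_of_finite_dimension:
  assumes "subfield K R" "finite_dimension K (carrier R)" "x \<in> carrier R"
  shows "(algebraic over K) x"
  using finite_dimension_imp_algebraic[OF assms(1) carrier_is_subring assms(2,3)] .

text \<open>As \<open>x\<close> is algebraic over \<open>E\<close>, the ring
  \<open>simple_extension E x\<close> is a field; it contains \<open>K\<close> and \<open>x\<close>,
  hence everything they generate. This makes the degree of \<open>Irr E x\<close> equal to the
  degree of the whole field over \<open>E\<close>.\<close>

lemma simple_extension_eq_carrier:
  assumes K: "subfield K R" "finite_dimension K (carrier R)"
    and x: "x \<in> carrier R" "adjoin R K x = carrier R"
    and E: "subfield E R" "K \<subseteq> E"
  shows "simple_extension E x = carrier R"
proof
  show "simple_extension E x \<subseteq> carrier R"
    using simple_extension_in_carrier[OF subfieldE(3)[OF E(1)] x(1)] .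
  have "subfield (simple_extension E x) R"
    using simple_extension_is_subfield[OF E(1) x(1)] algebraic_of_finite_dimension[OF E(1) _ x(1)]
      finite_dimension_subfield_mono[OF K E] by blast
  moreover have "insert x K \<subseteq> simple_extension E x"
    using simple_extension_mem[OF subfieldE(1)[OF E(1)] x(1)] E(2)
      simple_extension_incl[OF subfieldE(3)[OF E(1)] x(1)] by blast
  ultimately have "adjoin R K x \<subseteq> simple_extension E x"
    unfolding adjoin_def
    using generate_field_min_subfield1 x(1) subfieldE(3)[OF K(1)] by simp
  then show "carrier R \<subseteq> simple_extension E x"
    using x(2) by simp
qed

text \<open>By the tower law \<open>d\<close> is \<open>e\<close> times the degree of
  \<open>F\<close> over \<open>E\<close>. So \<open>d \<le> e\<close> forces that degree to be at
  most 1, and then the list \<open>[\<one>]\<close> is a basis over \<open>E\<close> of both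
  fields.\<close>

lemma subfield_eq_of_dimension_le:
  assumes E: "subfield E R" and F: "subfield F R" "E \<subseteq> F"
    and dims: "dimension d E (carrier R)" "dimension e F (carrier R)" "d \<le> e"
  shows "E = F"
proof -
  have "subalgebra E F R"
    using intermediate_field_subspace F by (simp add: intermediate_field_def)
  then obtain k where k: "dimension k E F"
    using subalbegra_incl_imp_finite_dimension[OF E finite_dimensionI[OF dims(1)]]
      subfieldE(3)[OF F(1)] by blast
  \<comment> \<open>Positivity allows \<open>e\<close> to be cancelled in
    \<open>k * e \<le> e\<close> below.\<close>
  have "e > 0"
  proof (rule ccontr)
    assume "\<not> e > 0"
    then have "carrier R = {\<zero>}"
      using dimension_zero[OF F(1)] dims(2) by simp
    then show False
      using one_closed one_not_zero by blast
  qed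
  moreover have "k * e = d"
    using telescopic_base[OF E F(1) k dims(2)] dimension_is_inj[OF E] dims(1) by blast
  ultimately have "k \<le> 1"
    using dims(3) by (metis mult_le_cancel2 nat_mult_1)
  moreover have ind: "independent E [\<one>]"
    using li_Cons[of \<one> E "[]"] by simp
  have "\<one> \<in> F" and "\<one> \<in> E"
    using subringE(3)[OF subfieldE(1)] E F(1) by auto
  ultimately have "Span E [\<one>] = F"
    using independent_length_le_dimension[OF E k ind] independent_length_eq_dimension[OF E k ind]
    by simp
  moreover have "Span E [\<one>] = E"
    using independent_length_eq_dimension[OF E dimension_one[OF E] ind] \<open>\<one> \<in> E\<close> by simp
  ultimately show ?thesis
    by simp
qed

text \<open>The common minimal polynomial has its coefficients in \<open>E \<inter> F\<close>, so
  the minimal polynomial of \<open>x\<close> over \<open>E \<inter> F\<close> divides it and has no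
  larger degree. These degrees are those of the whole field over \<open>E \<inter> F\<close> and
  over \<open>E\<close>, so the two subfields coincide. By symmetry, \<open>Irr F x\<close>
  determines \<open>F\<close>.\<close>

lemma intermediate_field_le_of_Irr_eq:
  assumes K: "subfield K R" "finite_dimension K (carrier R)"
    and x: "x \<in> carrier R" "adjoin R K x = carrier R"
    and E: "intermediate_field R K E" and F: "intermediate_field R K F"
    and eq: "Irr E x = Irr F x"
  shows "E \<subseteq> F"
proof -
  have sub: "subfield E R" "K \<subseteq> E" "subfield F R" "K \<subseteq> F"
    using E F by (auto simp: intermediate_field_def)
  have I: "subfield (E \<inter> F) R" "K \<subseteq> E \<inter> F"
    using subfield_inter sub by auto
  have alg: "(algebraic over H) x" if "subfield H R" "K \<subseteq> H" for H
    using algebraic_of_finite_dimension[OF that(1) _ x(1)] finite_dimension_subfield_mono[OF K that] .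
  have dim: "dimension (degree (Irr H x)) H (carrier R)" if "subfield H R" "K \<subseteq> H" for H
    using dimension_simple_extension[OF that(1) x(1) alg[OF that]]
      simple_extension_eq_carrier[OF K x that] by simp
  have irr: "polynomial E (Irr E x)" "polynomial F (Irr E x)"
    using IrrE(1)[OF sub(1) x(1) alg] IrrE(1)[OF sub(3) x(1) alg] sub eq
    by (simp_all add: univ_poly_carrier)
  then have mem: "Irr E x \<in> carrier ((E \<inter> F)[X])"
    by (auto simp: univ_poly_carrier[symmetric] polynomial_def)
  have "Irr (E \<inter> F) x pdivides Irr E x"
    using Irr_minimal[OF I(1) x(1) alg[OF I] mem] IrrE(4)[OF sub(1) x(1) alg] sub by simp
  moreover have "Irr E x \<noteq> []"
    using pirreducibleE(1)[OF subfieldE(1)] IrrE(1,2)[OF sub(1) x(1) alg] sub by blast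
  ultimately have "degree (Irr (E \<inter> F) x) \<le> degree (Irr E x)"
    using pdivides_imp_degree_le[OF subfieldE(1)[OF I(1)] IrrE(1)[OF I(1) x(1) alg[OF I]] mem] by blast
  then have "E \<inter> F = E"
    using subfield_eq_of_dimension_le[OF I(1) sub(1) _ dim[OF I] dim[OF sub(1,2)]] by blast
  then show ?thesis
    by (simp add: inf.absorb_iff1)
qed

lemma finite_intermediate_fields:
  assumes K: "subfield K R" "finite_dimension K (carrier R)"
    and simple: "simple_field_extension R K"
  shows "finite {F. intermediate_field R K F}"
proof -
  obtain x where x: "x \<in> carrier R" "adjoin R K x = carrier R"
    using simple by (auto simp: simple_field_extension_def)
  have alg: "(algebraic over H) x" if "intermediate_field R K H" for H
    using algebraic_of_finite_dimension[OF _ _ x(1)] finite_dimension_subfield_mono[OF K] that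
    by (simp add: intermediate_field_def)
  have KK: "intermediate_field R K K"
    using K by (simp add: intermediate_field_def)
  let ?p = "Irr K x"
  \<comment> \<open>All the minimal polynomials \<open>Irr F x\<close>, whose coefficient fields
    vary, are compared inside the single ring \<open>poly_ring R\<close>.\<close>
  let ?D = "{q \<in> carrier (poly_ring R). q \<noteq> [] \<and> lead_coeff q = \<one> \<and> q pdivides ?p}"
  show ?thesis
  proof (rule inj_on_finite)
    show "inj_on (\<lambda>F. Irr F x) {F. intermediate_field R K F}"
    proof (rule inj_onI; clarify)
      fix E F assume EF: "intermediate_field R K E" "intermediate_field R K F" "Irr E x = Irr F x"
      show "E = F"
        using intermediate_field_le_of_Irr_eq[OF K x EF]
          intermediate_field_le_of_Irr_eq[OF K x EF(2,1) EF(3)[symmetric]]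
        by (rule equalityI)
    qed
    show "(\<lambda>F. Irr F x) ` {F. intermediate_field R K F} \<subseteq> ?D"
    proof (rule image_subsetI)
      fix F assume "F \<in> {F. intermediate_field R K F}"
      then have F: "intermediate_field R K F" "subfield F R" "K \<subseteq> F"
        by (auto simp: intermediate_field_def)
      note Irr = IrrE[OF F(2) x(1) alg[OF F(1)]]
      have "?p \<in> carrier (F[X])"
        using IrrE(1)[OF K(1) x(1) alg[OF KK]] F(3)
        by (auto simp: univ_poly_carrier[symmetric] polynomial_def)
      then have "Irr F x pdivides ?p"
        using Irr_minimal[OF F(2) x(1) alg[OF F(1)]] IrrE(4)[OF K(1) x(1) alg[OF KK]] by blast
      moreover have "Irr F x \<noteq> []"
        using pirreducibleE(1)[OF subfieldE(1)[OF F(2)] Irr(1,2)] .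
      ultimately show "Irr F x \<in> ?D"
        using Irr(3) carrier_polynomial_shell[OF subfieldE(1)[OF F(2)] Irr(1)] by blast
    qed
    show "finite ?D"
      using finite_monic_divisors carrier_polynomial_shell[OF subfieldE(1)[OF K(1)]]
        IrrE(1,2)[OF K(1) x(1) alg[OF KK]] pirreducibleE(1)[OF subfieldE(1)[OF K(1)]] by blast
  qed
qed


section \<open>Avoiding finitely many subspaces\<close>

lemma subalgebra_props:
  assumes "subalgebra K V R"
  shows "V \<subseteq> carrier R" "\<zero> \<in> V"
    and "\<And>u v. \<lbrakk> u \<in> V; v \<in> V \<rbrakk> \<Longrightarrow> u \<oplus> v \<in> V"
    and "\<And>v. v \<in> V \<Longrightarrow> \<ominus> v \<in> V"
    and "\<And>k v. \<lbrakk> k \<in> K; v \<in> V \<rbrakk> \<Longrightarrow> k \<otimes> v \<in> V"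
proof -
  \<comment> \<open>The locale makes \<open>V\<close> a subgroup of the additive monoid, so
    \<open>V.one_closed\<close>, \<open>V.m_closed\<close> and \<open>V.m_inv_closed\<close> speak
    of zero, sums and negatives.\<close>
  interpret V: subalgebra K V R
    by fact
  show "V \<subseteq> carrier R" "\<zero> \<in> V"
    and "\<And>u v. \<lbrakk> u \<in> V; v \<in> V \<rbrakk> \<Longrightarrow> u \<oplus> v \<in> V"
    and "\<And>k v. \<lbrakk> k \<in> K; v \<in> V \<rbrakk> \<Longrightarrow> k \<otimes> v \<in> V"
    using V.subset V.one_closed V.m_closed V.smult_closed by auto
  show "\<And>v. v \<in> V \<Longrightarrow> \<ominus> v \<in> V"
    using V.m_inv_closed by (simp add: a_inv_def)
qed

lemma subalgebra_scale_cancel: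
  assumes K: "subfield K R" and V: "subalgebra K V R"
    and kv: "k \<in> K" "k \<noteq> \<zero>" "v \<in> carrier R" "k \<otimes> v \<in> V"
  shows "v \<in> V"
proof -
  have k: "inv k \<in> K" "inv k \<otimes> k = \<one>" "k \<in> carrier R" "inv k \<in> carrier R"
    using subfield_m_inv[OF K, of k] subfieldE(3)[OF K] kv(1,2) by auto
  have "inv k \<otimes> (k \<otimes> v) = v"
    using k kv(3) by (simp add: m_assoc[symmetric])
  then show ?thesis
    using subalgebra_props(5)[OF V k(1) kv(4)] by simp
qed

text \<open>Induction on \<open>S\<close>: let \<open>v\<close> avoid the old subspaces but lie in
  the new one \<open>U\<close>, and take \<open>w\<close> outside \<open>U\<close>. The line of all
  \<open>w \<oplus> k \<otimes> v\<close> misses \<open>U\<close> and meets each old subspace in at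
  most one point, so the infinite field \<open>K\<close> supplies a suitable
  \<open>k\<close>.\<close>

lemma finite_subspaces_not_cover:
  assumes K: "subfield K R" "infinite K"
    and S: "finite S" "\<And>U. U \<in> S \<Longrightarrow> subalgebra K U R" "\<And>U. U \<in> S \<Longrightarrow> U \<noteq> carrier R"
  shows "\<exists>v \<in> carrier R. \<forall>U \<in> S. v \<notin> U"
  using S
proof (induction S rule: finite_induct)
  case (insert U S)
  then obtain v where v: "v \<in> carrier R" "\<And>T. T \<in> S \<Longrightarrow> v \<notin> T"
    by auto
  have U: "subalgebra K U R" "U \<noteq> carrier R"
    using insert.prems by auto
  show ?case
  proof (cases "v \<in> U")
    case False
    then show ?thesis
      using v by auto
  next
    case True
    obtain w where w: "w \<in> carrier R" "w \<notin> U"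
      using U subalgebra_props(1)[OF U(1)] by blast
    have Kc: "K \<subseteq> carrier R"
      using subfieldE(3)[OF K(1)] .
    have "finite {k \<in> K. w \<oplus> k \<otimes> v \<in> T}" if T: "T \<in> S" for T
    proof -
      note sT = subalgebra_props[OF insert.prems(1)[of T]]
      have "k = l" if kl: "k \<in> K" "l \<in> K" "w \<oplus> k \<otimes> v \<in> T" "w \<oplus> l \<otimes> v \<in> T" for k l
      proof (rule ccontr)
        assume "k \<noteq> l"
        have c: "k \<in> carrier R" "l \<in> carrier R"
          using kl Kc by auto
        have "k \<ominus> l \<in> K"
          using kl(1,2) subringE(5,7)[OF subfieldE(1)[OF K(1)]] by (simp add: a_minus_def)
        moreover have "k \<ominus> l \<noteq> \<zero>"
          using c \<open>k \<noteq> l\<close> by simp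
        moreover have "(k \<ominus> l) \<otimes> v \<in> T"
        proof -
          \<comment> \<open>Two points of the line in \<open>T\<close> would put a nonzero multiple
            of its direction \<open>v\<close>, and hence \<open>v\<close> itself, into
            \<open>T\<close>.\<close>
          have "(k \<ominus> l) \<otimes> v = (w \<oplus> k \<otimes> v) \<oplus> \<ominus> (w \<oplus> l \<otimes> v)"
            using c v(1) w(1) by algebra
          then show ?thesis
            using sT(3,4) T kl(3,4) by simp
        qed
        ultimately have "v \<in> T"
          using subalgebra_scale_cancel[OF K(1)] insert.prems(1)[of T] T v(1) by blast
        then show False
          using v(2) T by blast
      qed
      then have "{k \<in> K. w \<oplus> k \<otimes> v \<in> T} \<subseteq> {k}" if "k \<in> K" "w \<oplus> k \<otimes> v \<in> T" for k
        using that by blast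
      then show ?thesis
        by (metis (mono_tags, lifting) Collect_empty_eq finite.emptyI finite.insertI finite_subset)
    qed
    then have "finite (\<Union>T\<in>S. {k \<in> K. w \<oplus> k \<otimes> v \<in> T})"
      using insert.hyps(1) by blast
    then have "K - (\<Union>T\<in>S. {k \<in> K. w \<oplus> k \<otimes> v \<in> T}) \<noteq> {}"
      using Diff_infinite_finite[OF _ K(2)] infinite_imp_nonempty by blast
    then obtain k where k: "k \<in> K" "\<And>T. T \<in> S \<Longrightarrow> w \<oplus> k \<otimes> v \<notin> T"
      by blast
    have kv: "k \<otimes> v \<in> U" "k \<otimes> v \<in> carrier R"
      using subalgebra_props(5)[OF U(1) k(1) True] k(1) Kc v(1) by auto
    have "w \<oplus> k \<otimes> v \<notin> U"
    proof
      assume "w \<oplus> k \<otimes> v \<in> U"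
      then have "(w \<oplus> k \<otimes> v) \<oplus> \<ominus> (k \<otimes> v) \<in> U"
        using subalgebra_props(3,4)[OF U(1)] kv(1) by blast
      moreover have "(w \<oplus> k \<otimes> v) \<oplus> \<ominus> (k \<otimes> v) = w"
        using w(1) kv(2) by algebra
      ultimately show False
        using w(2) by simp
    qed
    then show ?thesis
      using k(2) w(1) kv(2) by (intro bexI[of _ "w \<oplus> k \<otimes> v"]) auto
  qed
qed auto

text \<open>An element \<open>k \<otimes> v \<oplus> y\<close> of \<open>U\<close> with
  \<open>y\<close> in \<open>V\<close> and \<open>k\<close> nonzero could be solved for
  \<open>v\<close>, placing \<open>v\<close> in the sum of \<open>V\<close> and \<open>U\<close>. So
  \<open>k\<close> is zero and the element already lies in \<open>V \<inter> U\<close>.\<close>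

lemma line_extension_inter_trivial:
  assumes K: "subfield K R" and V: "subalgebra K V R" and U: "subalgebra K U R"
    and VU: "V \<inter> U = {\<zero>}"
    and v: "v \<in> carrier R" "v \<notin> V <+>\<^bsub>R\<^esub> U"
  shows "line_extension K v V \<inter> U = {\<zero>}"
proof
  show "line_extension K v V \<inter> U \<subseteq> {\<zero>}"
  proof
    fix u assume u: "u \<in> line_extension K v V \<inter> U"
    then obtain k y where ky: "k \<in> K" "y \<in> V" "u = k \<otimes> v \<oplus> y"
      using line_extension_mem_iff by auto
    have c: "k \<in> carrier R" "y \<in> carrier R" "u \<in> carrier R"
      using ky subfieldE(3)[OF K] subalgebra_props(1)[OF V] subalgebra_props(1)[OF U] u by auto
    have "k = \<zero>"
    proof (rule ccontr)
      assume "k \<noteq> \<zero>"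
      then have k: "inv k \<in> K" "inv k \<otimes> k = \<one>" "inv k \<in> carrier R"
        using subfield_m_inv[OF K, of k] subfieldE(3)[OF K] ky(1) by auto
      have "v = inv k \<otimes> k \<otimes> v"
        using k v(1) by simp
      also have "\<dots> = inv k \<otimes> (\<ominus> y) \<oplus> inv k \<otimes> u"
        unfolding ky(3) using c k(3) v(1) by algebra
      finally have "v = inv k \<otimes> (\<ominus> y) \<oplus> inv k \<otimes> u" .
      moreover have "inv k \<otimes> (\<ominus> y) \<in> V" "inv k \<otimes> u \<in> U"
        using subalgebra_props(4,5)[OF V] subalgebra_props(5)[OF U] k(1) ky(2) u by simp_all
      ultimately have "v \<in> V <+>\<^bsub>R\<^esub> U"
        unfolding set_add_def' by blast
      then show False
        using v(2) by simp
    qed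
    then have "u = y"
      using ky c v(1) by simp
    then show "u \<in> {\<zero>}"
      using VU ky(2) u by blast
  qed
  have "\<zero> = \<zero> \<otimes> v \<oplus> \<zero>"
    using v(1) by simp
  then show "{\<zero>} \<subseteq> line_extension K v V \<inter> U"
    using line_extension_mem_iff[of \<zero> K v V] subalgebra_props(2)[OF V] subalgebra_props(2)[OF U]
      subringE(2)[OF subfieldE(1)[OF K]] by blast
qed

text \<open>Greedy construction: one vector is added at a time, chosen outside all the sums of the
  current \<open>V\<close> with a member of \<open>S\<close>. The bound \<open>j + m \<le> n\<close>
  keeps these sums proper until dimension \<open>j\<close> is reached.\<close>

lemma exists_common_transversal_subspace:
  assumes K: "subfield K R" "infinite K" and n: "dimension n K (carrier R)"
    and S: "finite S" "\<And>U. U \<in> S \<Longrightarrow> \<exists>d \<le> m. dimension d K U"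
  shows "j + m \<le> n \<Longrightarrow> \<exists>V. dimension j K V \<and> (\<forall>U \<in> S. V \<inter> U = {\<zero>})"
proof (induction j)
  case 0
  have "{\<zero>} \<inter> U = {\<zero>}" if "U \<in> S" for U
    using S(2)[OF that] space_subgroup_props(2)[OF K(1)] by blast
  then show ?case
    using zero_dim by blast
next
  case (Suc j)
  then obtain V where V: "dimension j K V" "\<And>U. U \<in> S \<Longrightarrow> V \<inter> U = {\<zero>}"
    by auto
  have alg: "subalgebra K W R" if "dimension d K W" for d W
    using finite_dimension_imp_subalgebra[OF K(1) finite_dimensionI[OF that]] .
  \<comment> \<open>\<open>{\<zero>}\<close> is added to make the new vector lie outside \<open>V\<close> even if \<open>S\<close> is empty.\<close>
  let ?S = "insert {\<zero>} S"
  have S': "\<exists>d \<le> m. dimension d K U" "V \<inter> U = {\<zero>}" if "U \<in> ?S" for U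
    using that S(2) V space_subgroup_props(2)[OF K(1) V(1)] zero_dim by auto
  have sum: "subalgebra K (V <+>\<^bsub>R\<^esub> U) R" "V <+>\<^bsub>R\<^esub> U \<noteq> carrier R" if U: "U \<in> ?S" for U
  proof -
    obtain d where d: "d \<le> m" "dimension d K U"
      using S'(1)[OF U] by blast
    have dim: "dimension (j + d) K (V <+>\<^bsub>R\<^esub> U)"
      using dimension_direct_sum_space[OF K(1) V(1) d(2) S'(2)[OF U]] .
    then show "subalgebra K (V <+>\<^bsub>R\<^esub> U) R"
      by (rule alg)
    show "V <+>\<^bsub>R\<^esub> U \<noteq> carrier R"
      \<comment> \<open>In the induction step the bound reads \<open>Suc j + m \<le> n\<close>,
        whence \<open>j + d < n\<close>.\<close>
      using dimension_is_inj[OF K(1) dim, of n] n d(1) Suc.prems by auto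
  qed
  have "\<exists>v \<in> carrier R. \<forall>T \<in> (\<lambda>U. V <+>\<^bsub>R\<^esub> U) ` ?S. v \<notin> T"
    by (rule finite_subspaces_not_cover[OF K]) (use S(1) sum in auto)
  then obtain v where v: "v \<in> carrier R" "\<And>U. U \<in> ?S \<Longrightarrow> v \<notin> V <+>\<^bsub>R\<^esub> U"
    by blast
  have "v \<notin> V"
  proof
    assume "v \<in> V"
    moreover have "v = v \<oplus> \<zero>"
      using v(1) by simp
    ultimately have "v \<in> V <+>\<^bsub>R\<^esub> {\<zero>}"
      unfolding set_add_def' by blast
    then show False
      using v(2) by simp
  qed
  then have "dimension (Suc j) K (line_extension K v V)"
    using Suc_dim v(1) V(1) by blast
  moreover have "line_extension K v V \<inter> U = {\<zero>}" if "U \<in> S" for U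
    using line_extension_inter_trivial[OF K(1) alg[OF V(1)] _ V(2)[OF that] v(1)] v(2) S(2)[OF that] that
      alg by blast
  ultimately show ?case
    by blast
qed


section \<open>Primitive subspaces\<close>

lemma intermediate_field_adjoin:
  assumes "subfield K R" "a \<in> carrier R"
  shows "intermediate_field R K (adjoin R K a)" "a \<in> adjoin R K a"
proof -
  have "insert a K \<subseteq> carrier R"
    using subfieldE(3)[OF assms(1)] assms(2) by simp
  then show "intermediate_field R K (adjoin R K a)" "a \<in> adjoin R K a"
    using generate_fieldE(1,2)[OF _ refl, of "insert a K"]
    by (auto simp: intermediate_field_def adjoin_def)
qed

lemma primitive_subspace_iff:
  assumes K: "subfield K R"
  shows "primitive_subspace R K V \<longleftrightarrow> subalgebra K V R \<and>
    (\<forall>F. intermediate_field R K F \<and> F \<noteq> carrier R \<longrightarrow> V \<inter> F = {\<zero>})"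
proof (intro iffI conjI allI impI)
  assume V: "primitive_subspace R K V"
  then show "subalgebra K V R"
    by (simp add: primitive_subspace_def)
  fix F assume F: "intermediate_field R K F \<and> F \<noteq> carrier R"
  have sub: "subfield F R" "K \<subseteq> F"
    using F by (auto simp: intermediate_field_def)
  have "a = \<zero>" if a: "a \<in> V" "a \<in> F" for a
  proof (rule ccontr)
    assume "a \<noteq> \<zero>"
    then have "adjoin R K a = carrier R"
      using V a(1) by (simp add: primitive_subspace_def)
    moreover have "adjoin R K a \<subseteq> F"
      unfolding adjoin_def using generate_field_min_subfield1[OF _ sub(1), of "insert a K"] a(2) sub
        subfieldE(3)[OF sub(1)] by blast
    ultimately show False
      using F subfieldE(3)[OF sub(1)] by blast
  qed
  moreover have "\<zero> \<in> V" "\<zero> \<in> F"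
    using subalgebra_props(2) \<open>subalgebra K V R\<close> subringE(2)[OF subfieldE(1)[OF sub(1)]] by blast+
  ultimately show "V \<inter> F = {\<zero>}"
    by blast
next
  assume V: "subalgebra K V R \<and>
    (\<forall>F. intermediate_field R K F \<and> F \<noteq> carrier R \<longrightarrow> V \<inter> F = {\<zero>})"
  \<comment> \<open>Otherwise \<open>adjoin R K a\<close> would be a proper intermediate field
    meeting \<open>V\<close> in the nonzero element \<open>a\<close>.\<close>
  have "adjoin R K a = carrier R" if a: "a \<in> V" "a \<noteq> \<zero>" for a
    using intermediate_field_adjoin[OF K, of a] V subalgebra_props(1)[of K V] a by blast
  then show "primitive_subspace R K V"
    using V by (simp add: primitive_subspace_def)
qed

text \<open>The sum form avoids the truncated subtraction of natural numbers.\<close>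

lemma max_primitive_dim_add_max_proper_degree:
  assumes K: "subfield K R" "infinite K" and fin: "finite_dimension K (carrier R)"
    and simple: "simple_field_extension R K" and proper: "K \<noteq> carrier R"
  shows "max_primitive_dim R K + max_proper_degree R K = dim K (carrier R)"
proof -
  \<comment> \<open>The next two facts translate between the number \<open>dim K W\<close> and the
    relation \<open>dimension d K W\<close>.\<close>
  have dimE: "dimension (dim K W) K W" if "subalgebra K W R" for W
    using finite_dimensionE[OF K(1) subspace_dim_le(1)[OF K(1) fin that]] by (simp add: over_def)
  have dim_eq: "dim K W = d" if "dimension d K W" for d W
    using dimI[OF K(1) that] by (simp add: over_def)
  let ?n = "dim K (carrier R)"
  let ?m = "max_proper_degree R K"
  let ?P = "{dim K V | V. primitive_subspace R K V}"
  let ?F = "{F. intermediate_field R K F \<and> F \<noteq> carrier R}"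
  have n: "dimension ?n K (carrier R)"
    using dimE carrier_is_subalgebra[OF subfieldE(3)[OF K(1)]] by blast
  note wf = max_proper_degree_wf[OF K(1) fin proper]
  have "\<exists>F. ?m = dim K F \<and> intermediate_field R K F \<and> F \<noteq> carrier R"
    using Max_in[OF wf] unfolding max_proper_degree_def by (rule CollectD)
  then obtain F where F: "intermediate_field R K F" "F \<noteq> carrier R" "dim K F = ?m"
    by metis
  have le_m: "dim K E \<le> ?m" if "E \<in> ?F" for E
    unfolding max_proper_degree_def using Max_ge[OF wf(1)] that by blast
  have upper: "dim K V + ?m \<le> ?n" if V: "primitive_subspace R K V" for V
  proof -
    have V': "subalgebra K V R" "V \<inter> F = {\<zero>}"
      using V primitive_subspace_iff[OF K(1)] F(1,2) by auto
    \<comment> \<open>The sum of \<open>V\<close> and the maximal proper field \<open>F\<close> is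
      direct, and its dimension cannot exceed that of the whole field.\<close>
    have "dimension (dim K V + dim K F) K (V <+>\<^bsub>R\<^esub> F)"
      using dimension_direct_sum_space[OF K(1) dimE dimE V'(2)] V'(1)
        intermediate_field_subspace[OF F(1)] by blast
    then show ?thesis
      using subspace_dim_le(2)[OF K(1) fin finite_dimension_imp_subalgebra[OF K(1) finite_dimensionI]]
        dim_eq F(3) by metis
  qed
  have "finite ?F"
    by (rule finite_subset[OF _ finite_intermediate_fields[OF K(1) fin simple]]) blast
  moreover have "\<exists>d \<le> ?m. dimension d K E" if "E \<in> ?F" for E
    using le_m[OF that] dimE intermediate_field_subspace that by blast
  moreover have "?m \<le> ?n"
    using subspace_dim_le(2)[OF K(1) fin intermediate_field_subspace[OF F(1)]] F(3) by simp
  \<comment> \<open>The bound is met with equality: \<open>?n - ?m\<close> is the largest dimension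
    that the greedy construction reaches when all members of \<open>?F\<close> have degree at most
    \<open>?m\<close>.\<close>
  ultimately obtain V where V: "dimension (?n - ?m) K V" "\<forall>U\<in>?F. V \<inter> U = {\<zero>}"
    using exists_common_transversal_subspace[OF K n, of ?F ?m "?n - ?m"] by auto
  then have "primitive_subspace R K V"
    using primitive_subspace_iff[OF K(1)]
      finite_dimension_imp_subalgebra[OF K(1) finite_dimensionI[OF V(1)]] by blast
  then have "?n - ?m \<in> ?P"
    using dim_eq[OF V(1)] by (metis (mono_tags, lifting) mem_Collect_eq)
  then have "max_primitive_dim R K = ?n - ?m"
    unfolding max_primitive_dim_def
    using max_primitive_dim_wf(1)[OF K(1) fin] upper by (intro Max_eqI) fastforce+
  then show ?thesis
    using \<open>?m \<le> ?n\<close> by simp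
qed

end

theorem theorem7:
  fixes L :: "('a, 'b) ring_scheme" and K :: "'a set"
  assumes "field L"
    and "subfield K L"
    and "infinite K"
    and "ring.finite_dimension L K (carrier L)"
    and "simple_field_extension L K"
    and "K \<noteq> carrier L"
  shows "int (max_primitive_dim L K) =
         int (ring.dim L K (carrier L)) - int (max_proper_degree L K)"
  using field.max_primitive_dim_add_max_proper_degree[OF assms] by linarith

end
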